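(* Let $k$ be a positive integer and let $G$ be a simple finite $(2k-1)$-connected graph with maximum degree $\Delta=\Delta(G)$. Then the total graph $T(G)$ contains $K_{\Delta+k}$ as a minor.
   Context: The total graph $T(G)$ has vertex set $V(G)\cup E(G)$, two elements being adjacent in $T(G)$ if they are adjacent vertices, adjacent edges (sharing an endpoint), or an edge and one of its endpoints in $G$. A graph $H$ is a minor of $G$ if a graph isomorphic to $H$ can be obtained from $G$ by vertex deletions, edge deletions and edge contractions. $(2k-1)$-connected means vertex-connectivity at least $2k-1$. *)

theory Defs
  imports "Graph_Theory.Graph_Theory"
begin

text \<open>
  A finite simple graph is a \<^locale>\<open>pair_graph\<close>: a finite, symmetric, loop-free relation on
  a finite vertex set. An undirected edge \<open>uv\<close> is present as both arcs \<open>(u, v)\<close> and \<open>(v, u)\<close>;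
  \<open>edges\<close> identifies the two.
\<close>

definition edges :: "'a pair_pre_digraph \<Rightarrow> 'a set set" where
  "edges G = {{u, v} | u v. (u, v) \<in> parcs G}"

text \<open>In a symmetric graph the out-degree is the number of neighbours.\<close>

definition max_degree :: "'a pair_pre_digraph \<Rightarrow> nat" where
  "max_degree G = Max (out_degree (with_proj G) ` pverts G)"

text \<open>
  The smallest number of vertices whose deletion leaves a disconnected graph or a single vertex,
  so that the complete graph on \<open>n \<ge> 1\<close> vertices has connectivity \<open>n - 1\<close>. The library's
  \<^const>\<open>Digraph_Component.connected\<close> excludes the empty graph, whose connectivity is therefore 0.
\<close>

definition vertex_connectivity :: "'a pair_pre_digraph \<Rightarrow> nat" where
  "vertex_connectivity G =
    (LEAST n. \<exists>S \<subseteq> pverts G. card S = n \<and>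
      (\<not> Digraph_Component.connected (with_proj G \<restriction> (pverts G - S)) \<or> card (pverts G - S) = 1))"

definition vertex_connected :: "nat \<Rightarrow> 'a pair_pre_digraph \<Rightarrow> bool" where
  "vertex_connected k G \<longleftrightarrow> k \<le> vertex_connectivity G"

definition total_graph :: "'a pair_pre_digraph \<Rightarrow> ('a + 'a set) pair_pre_digraph" where
  "total_graph G = \<lparr>
     pverts = Inl ` pverts G \<union> Inr ` edges G,
     parcs = {(Inl u, Inl v) | u v. (u, v) \<in> parcs G}
       \<union> {(Inr e, Inr f) | e f. e \<in> edges G \<and> f \<in> edges G \<and> e \<noteq> f \<and> e \<inter> f \<noteq> {}}
       \<union> {(Inl v, Inr e) | v e. e \<in> edges G \<and> v \<in> e}
       \<union> {(Inr e, Inl v) | v e. e \<in> edges G \<and> v \<in> e} \<rparr>"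

definition delete_vertex :: "'a \<Rightarrow> 'a pair_pre_digraph \<Rightarrow> 'a pair_pre_digraph" where
  "delete_vertex v G =
    \<lparr> pverts = pverts G - {v}, parcs = {(x, y) \<in> parcs G. x \<noteq> v \<and> y \<noteq> v} \<rparr>"

definition delete_edge :: "'a \<Rightarrow> 'a \<Rightarrow> 'a pair_pre_digraph \<Rightarrow> 'a pair_pre_digraph" where
  "delete_edge u v G = \<lparr> pverts = pverts G, parcs = parcs G - {(u, v), (v, u)} \<rparr>"

text \<open>
  Contraction of the edge \<open>uv\<close>: the merged vertex keeps the name \<open>u\<close>. Loops are dropped, and
  parallel edges coincide since arcs form a set, so the result is again simple.
\<close>

definition contract_edge :: "'a \<Rightarrow> 'a \<Rightarrow> 'a pair_pre_digraph \<Rightarrow> 'a pair_pre_digraph" where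
  "contract_edge u v G =
    (let r = (\<lambda>x. if x = v then u else x)
     in \<lparr> pverts = r ` pverts G, parcs = {(r x, r y) | x y. (x, y) \<in> parcs G \<and> r x \<noteq> r y} \<rparr>)"

inductive minor_step :: "'a pair_pre_digraph \<Rightarrow> 'a pair_pre_digraph \<Rightarrow> bool" where
  delete_vertex: "v \<in> pverts G \<Longrightarrow> minor_step G (delete_vertex v G)"
| delete_edge: "(u, v) \<in> parcs G \<Longrightarrow> minor_step G (delete_edge u v G)"
| contract_edge: "(u, v) \<in> parcs G \<Longrightarrow> minor_step G (contract_edge u v G)"

definition has_minor :: "'a pair_pre_digraph \<Rightarrow> 'b pair_pre_digraph \<Rightarrow> bool" where
  "has_minor G H \<longleftrightarrow> (\<exists>G'. minor_step\<^sup>*\<^sup>* G G' \<and> digraph_iso (with_proj H) (with_proj G'))"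

definition complete_graph :: "nat \<Rightarrow> nat pair_pre_digraph" where
  "complete_graph n = \<lparr> pverts = {..<n}, parcs = {(i, j). i < n \<and> j < n \<and> i \<noteq> j} \<rparr>"

lemma pair_graphI:
  assumes "finite (pverts G)" "parcs G \<subseteq> pverts G \<times> pverts G"
    and "\<And>x y. (x, y) \<in> parcs G \<Longrightarrow> (y, x) \<in> parcs G"
    and "\<And>x y. (x, y) \<in> parcs G \<Longrightarrow> x \<noteq> y"
  shows "pair_graph G"
proof
  show "finite (parcs G)"
    using assms(1,2) by (meson finite_SigmaI finite_subset)
  show "symmetric (with_proj G)"
    using assms(3) by (simp add: symmetric_def sym_def)
qed (use assms in auto)

lemma pair_graphD:
  assumes "pair_graph G"
  shows "finite (pverts G)" "parcs G \<subseteq> pverts G \<times> pverts G"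
    and "\<And>x y. (x, y) \<in> parcs G \<Longrightarrow> (y, x) \<in> parcs G"
    and "\<And>x y. (x, y) \<in> parcs G \<Longrightarrow> x \<noteq> y"
proof -
  interpret pair_graph G by fact
  show "finite (pverts G)" by (rule pair_finite_verts)
  show "parcs G \<subseteq> pverts G \<times> pverts G" by (auto dest: wellformed')
  show "\<And>x y. (x, y) \<in> parcs G \<Longrightarrow> (y, x) \<in> parcs G"
    using pair_sym_arcs by (simp add: symmetric_def sym_def)
  show "\<And>x y. (x, y) \<in> parcs G \<Longrightarrow> x \<noteq> y"
    using pair_no_loops by fastforce
qed

lemma complete_digraph_complete_graph: "complete_digraph n (with_proj (complete_graph n))"
proof -
  interpret pair_graph "complete_graph n"
    by (rule pair_graphI) (auto simp: complete_graph_def)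
  have "graph (with_proj (complete_graph n))" by unfold_locales
  then show ?thesis
    by (auto simp: complete_digraph_def complete_graph_def)
qed

lemma with_proj_delete_vertex:
  "with_proj (delete_vertex v G) = pre_digraph.del_vert (with_proj G) v"
  by (auto simp: with_proj_def delete_vertex_def pre_digraph.del_vert_def)

lemma pair_graph_total_graph:
  assumes "pair_graph G"
  shows "pair_graph (total_graph G)"
proof (rule pair_graphI)
  note G = pair_graphD[OF assms]
  have sub: "edges G \<subseteq> Pow (pverts G)"
    using G(2) by (auto simp: edges_def)
  then have "finite (edges G)"
    using G(1) by (meson finite_Pow_iff finite_subset)
  then show "finite (pverts (total_graph G))"
    using G(1) by (simp add: total_graph_def)
  show "parcs (total_graph G) \<subseteq> pverts (total_graph G) \<times> pverts (total_graph G)"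
    using G(2) sub by (auto simp: total_graph_def)
  show "(y, x) \<in> parcs (total_graph G)" if "(x, y) \<in> parcs (total_graph G)" for x y
    using that G(3) by (auto simp: total_graph_def)
  show "x \<noteq> y" if "(x, y) \<in> parcs (total_graph G)" for x y
    using that G(4) by (auto simp: total_graph_def)
qed

lemma pair_graph_minor_step:
  assumes "minor_step G H" "pair_graph G"
  shows "pair_graph H"
  using assms(1)
proof cases
  note G = pair_graphD[OF assms(2)]
  case (delete_vertex v)
  show ?thesis unfolding delete_vertex
    by (rule pair_graphI) (use G in \<open>auto simp: delete_vertex_def\<close>)
next
  note G = pair_graphD[OF assms(2)]
  case (delete_edge u v)
  show ?thesis unfolding delete_edge
    by (rule pair_graphI) (use G in \<open>auto simp: delete_edge_def\<close>)
next
  note G = pair_graphD[OF assms(2)]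
  case (contract_edge u v)
  obtain r where H: "H = \<lparr> pverts = r ` pverts G,
      parcs = {(r x, r y) | x y. (x, y) \<in> parcs G \<and> r x \<noteq> r y} \<rparr>"
    unfolding contract_edge contract_edge_def Let_def by blast
  show ?thesis unfolding H
    by (rule pair_graphI) (use G in \<open>auto, metis\<close>)
qed

lemma vertex_connected_iff:
  "vertex_connected k G \<longleftrightarrow>
    (\<forall>S \<subseteq> pverts G. card S < k \<longrightarrow>
      Digraph_Component.connected (with_proj G \<restriction> (pverts G - S)) \<and> card (pverts G - S) \<noteq> 1)"
proof -
  define P where "P n \<longleftrightarrow> (\<exists>S \<subseteq> pverts G. card S = n \<and>
      (\<not> Digraph_Component.connected (with_proj G \<restriction> (pverts G - S)) \<or> card (pverts G - S) = 1))" for n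
  have "P (card (pverts G))"
    unfolding P_def
    by (intro exI[of _ "pverts G"])
      (simp add: Digraph_Component.connected_def strongly_connected_def mk_symmetric_def)
  then have "k \<le> Least P \<longleftrightarrow> (\<forall>n<k. \<not> P n)"
    by (meson LeastI Least_le leI le_less_trans not_less_Least less_le_trans)
  moreover have "vertex_connected k G \<longleftrightarrow> k \<le> Least P"
    unfolding vertex_connected_def vertex_connectivity_def P_def ..
  ultimately show ?thesis
    unfolding P_def by blast
qed

end

theory Submission
  imports Defs
begin

text \<open>
  Let \<open>v\<close> have maximum degree \<open>\<Delta>\<close>. The edges at \<open>v\<close> form a clique of size \<open>\<Delta>\<close> in the total graph,
  and all vertices of \<open>G\<close> together form one further bag. Since \<open>G - v\<close> is \<open>2(k-1)\<close>-edge-connected,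
  it contains \<open>k - 1\<close> edge-disjoint connected spanning subgraphs (Nash-Williams, Tutte), whose edge
  sets are the remaining bags.

  The subgraphs come from Edmonds' base packing argument, carried out for a closure operator with
  the exchange property. Start with disjoint independent sets of maximal total size and let \<open>A\<close>
  consist of all elements that can be left uncovered after a sequence of exchanges. Then each
  member of the packing spans \<open>A\<close> within \<open>A\<close>. For the cycle matroid, if \<open>A\<close> had \<open>p \<ge> 2\<close> components,
  at most \<open>m(p - 1)\<close> edges would lie outside \<open>A\<close>, while \<open>2m\<close>-edge-connectivity forces at least \<open>mp\<close>.
\<close>

section \<open>Maximal packings of independent sets\<close>

text \<open>On a finite ground set these axioms describe matroid closures; \<open>exchange\<close>
  is the MacLane-Steinitz property.\<close>

locale closure_operator =
  fixes cl :: "'e set \<Rightarrow> 'e set"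
  assumes extensive: "A \<subseteq> cl A"
    and mono: "A \<subseteq> B \<Longrightarrow> cl A \<subseteq> cl B"
    and idem: "cl (cl A) \<subseteq> cl A"
    and exchange: "y \<in> cl (insert x A) \<Longrightarrow> y \<notin> cl A \<Longrightarrow> x \<in> cl (insert y A)"
begin

definition indep :: "'e set \<Rightarrow> bool" where
  "indep I \<longleftrightarrow> (\<forall>e\<in>I. e \<notin> cl (I - {e}))"

lemma cl_least: "A \<subseteq> cl B \<Longrightarrow> cl A \<subseteq> cl B"
  using mono idem by blast

lemma indep_subset: "indep I \<Longrightarrow> J \<subseteq> I \<Longrightarrow> indep J"
  unfolding indep_def by (meson Diff_mono mono order_refl subsetD)

text \<open>If some \<open>f\<close> in \<open>I\<close> became dependent on the other elements and
  \<open>e\<close>, the exchange property would turn this around and put \<open>e\<close> into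
  \<open>cl I\<close>.\<close>

lemma indep_insert:
  assumes "indep I" "e \<notin> cl I"
  shows "indep (insert e I)"
  unfolding indep_def
proof
  fix f assume f: "f \<in> insert e I"
  have "e \<notin> I" using assms(2) extensive by blast
  show "f \<notin> cl (insert e I - {f})"
  proof (cases "f = e")
    case True
    then show ?thesis using assms(2) \<open>e \<notin> I\<close> by simp
  next
    case False
    then have fI: "f \<in> I" and eq: "insert e I - {f} = insert e (I - {f})" using f by auto
    show ?thesis
    proof
      assume "f \<in> cl (insert e I - {f})"
      then have "e \<in> cl (insert f (I - {f}))"
        using exchange[of f e "I - {f}"] assms(1) fI unfolding eq indep_def by blast
      then show False using assms(2) fI by (simp add: insert_absorb)
    qed
  qed
qed

lemma cl_Diff_indep:
  assumes "indep I" "finite D" "D \<subseteq> I" "e \<in> cl I" "\<And>f. f \<in> D \<Longrightarrow> e \<in> cl (I - {f})"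
  shows "e \<in> cl (I - D)"
  using assms(2,3,5)
proof (induction D)
  case empty
  then show ?case using assms(4) by simp
next
  case (insert f D)
  let ?J = "I - insert f D"
  have e: "e \<in> cl (insert f ?J)"
    using insert mono[of "I - D" "insert f ?J"] by auto
  show ?case
  proof (rule ccontr)
    assume "e \<notin> cl ?J"
    then have "f \<in> cl (insert e ?J)" using exchange e by blast
    moreover have "insert e ?J \<subseteq> cl (I - {f})"
      using insert.prems(2)[of f] extensive[of "I - {f}"] by auto
    ultimately have "f \<in> cl (I - {f})" using cl_least by blast
    then show False using assms(1) insert.prems(1) by (auto simp: indep_def)
  qed
qed

section \<open>Packings of disjoint independent sets and exchanges between them\<close>

definition packing :: "'e set \<Rightarrow> nat \<Rightarrow> (nat \<Rightarrow> 'e set) \<Rightarrow> bool" where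
  "packing E m F \<longleftrightarrow> (\<forall>i<m. F i \<subseteq> E \<and> indep (F i)) \<and> (\<forall>i<m. \<forall>j<m. i \<noteq> j \<longrightarrow> F i \<inter> F j = {})"

lemma packingD:
  assumes "packing E m F"
  shows "i < m \<Longrightarrow> F i \<subseteq> E" "i < m \<Longrightarrow> indep (F i)"
    and "i < m \<Longrightarrow> j < m \<Longrightarrow> i \<noteq> j \<Longrightarrow> F i \<inter> F j = {}"
  using assms unfolding packing_def by metis+

lemma packingI:
  assumes "\<And>i. i < m \<Longrightarrow> F i \<subseteq> E" "\<And>i. i < m \<Longrightarrow> indep (F i)"
    and "\<And>i j. i < m \<Longrightarrow> j < m \<Longrightarrow> i \<noteq> j \<Longrightarrow> F i \<inter> F j = {}"
  shows "packing E m F"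
  unfolding packing_def using assms by metis

text \<open>A swap brings an uncovered \<open>e\<close> into \<open>F i\<close> in place of
  \<open>f\<close>, which becomes uncovered in turn. The closure condition keeps the new member
  independent.\<close>

inductive exchange_reachable :: "'e set \<Rightarrow> nat \<Rightarrow> (nat \<Rightarrow> 'e set) \<Rightarrow> (nat \<Rightarrow> 'e set) \<Rightarrow> bool"
  for E m F0 where
  start: "exchange_reachable E m F0 F0"
| swap: "exchange_reachable E m F0 F \<Longrightarrow> i < m \<Longrightarrow> e \<in> E - (\<Union>j<m. F j) \<Longrightarrow> f \<in> F i \<Longrightarrow>
    e \<notin> cl (F i - {f}) \<Longrightarrow> exchange_reachable E m F0 (F(i := insert e (F i - {f})))"

text \<open>Serves both moves: augmentation with \<open>J = F i\<close> and a swap with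
  \<open>J = F i - {f}\<close>.\<close>

lemma packing_update:
  assumes "packing E m F" "i < m" "e \<in> E - (\<Union>j<m. F j)" "J \<subseteq> F i" "e \<notin> cl J"
  shows "packing E m (F(i := insert e J))"
proof (rule packingI)
  let ?F = "F(i := insert e J)"
  note F = packingD[OF assms(1)]
  show "?F j \<subseteq> E" if "j < m" for j
    using F(1)[OF that] F(1)[OF assms(2)] assms(3,4) by auto
  show "indep (?F j)" if "j < m" for j
  proof (cases "j = i")
    case True
    have "indep (insert e J)"
      using indep_subset[OF F(2)[OF assms(2)] assms(4)] assms(5) by (rule indep_insert)
    then show ?thesis using True by simp
  qed (use F(2)[OF that] in simp)
  have sep: "insert e J \<inter> F j = {}" if "j < m" "j \<noteq> i" for j
    using F(3)[OF assms(2) that(1)] that assms(3,4) by blast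
  show "?F j \<inter> ?F l = {}" if "j < m" "l < m" "j \<noteq> l" for j l
    using F(3)[OF that] sep[of j] sep[of l] that by (simp split: if_splits) blast
qed

text \<open>The additive form avoids subtraction of natural numbers.\<close>

lemma sum_card_update:
  fixes i m :: nat
  assumes "i < m"
  shows "(\<Sum>j<m. card ((F(i := X)) j)) + card (F i) = (\<Sum>j<m. card (F j)) + card X"
proof -
  let ?S = "{..<m} - {i}"
  have split: "(\<Sum>j<m. card (F' j)) = card (F' i) + (\<Sum>j\<in>?S. card (F' j))" for F' :: "nat \<Rightarrow> 'b set"
    using assms by (intro sum.remove) auto
  have "(\<Sum>j\<in>?S. card ((F(i := X)) j)) = (\<Sum>j\<in>?S. card (F j))"
    by (rule sum.cong) auto
  then show ?thesis
    unfolding split[of F] split[of "F(i := X)"] fun_upd_same by linarith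
qed

text \<open>Preserving the total size is what matters: everything reachable from a maximal packing
  is again maximal.\<close>

lemma exchange_reachable_packing:
  assumes "exchange_reachable E m F0 F" "packing E m F0" "finite E"
  shows "packing E m F \<and> (\<Sum>j<m. card (F j)) = (\<Sum>j<m. card (F0 j))"
  using assms(1)
proof induction
  case start
  then show ?case using assms(2) by simp
next
  case (swap F i e f)
  have pack: "packing E m F" and eq: "(\<Sum>j<m. card (F j)) = (\<Sum>j<m. card (F0 j))"
    using swap.IH by blast+
  have fin: "finite (F i)"
    using packingD(1)[OF pack swap.hyps(2)] assms(3) by (rule finite_subset)
  have "e \<notin> F i" using swap.hyps(2,3) by blast
  then have "card (insert e (F i - {f})) = Suc (card (F i - {f}))"
    using fin by (simp del: card_Diff_insert)
  also have "\<dots> = card (F i)"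
    using fin swap.hyps(4) by (rule card_Suc_Diff1)
  finally have size: "(\<Sum>j<m. card ((F(i := insert e (F i - {f}))) j)) = (\<Sum>j<m. card (F j))"
    using sum_card_update[OF swap.hyps(2), of F "insert e (F i - {f})"] by linarith
  have "packing E m (F(i := insert e (F i - {f})))"
    using pack swap.hyps(2,3) Diff_subset swap.hyps(5) by (rule packing_update)
  then show ?case using trans[OF size eq] by (rule conjI)
qed

theorem maximal_packing_tight_set:
  assumes "finite E"
  obtains F A where "packing E m F" "A \<subseteq> E" "E - A \<subseteq> (\<Union>i<m. F i)"
    and "\<And>i. i < m \<Longrightarrow> A \<subseteq> cl (F i \<inter> A)"
proof -
  define size where "size F = (\<Sum>j<m. card (F j))" for F :: "nat \<Rightarrow> 'e set"
  have "packing E m (\<lambda>_. {})" by (simp add: packing_def indep_def)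
  moreover have "\<forall>F. packing E m F \<longrightarrow> size F < m * card E + 1"
  proof (intro allI impI)
    fix F assume "packing E m F"
    then have "card (F j) \<le> card E" if "j < m" for j
      using packingD(1) that assms card_mono by metis
    then have "size F \<le> (\<Sum>j<m. card E)" unfolding size_def by (intro sum_mono) simp
    then show "size F < m * card E + 1" by simp
  qed
  ultimately obtain F0 where F0: "packing E m F0"
    and max: "\<And>F. packing E m F \<Longrightarrow> size F \<le> size F0"
    using ex_has_greatest_nat[of "packing E m" "\<lambda>_. {}" size "m * card E + 1"] by blast
  define A where "A = {e \<in> E. \<exists>F. exchange_reachable E m F0 F \<and> e \<notin> (\<Union>j<m. F j)}"
  have uncovered: "e \<in> cl (F i \<inter> A)"
    if F: "exchange_reachable E m F0 F" and e: "e \<in> E - (\<Union>j<m. F j)" and i: "i < m" for F e i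
  proof -
    have pack: "packing E m F" and size: "size F = size F0"
      using exchange_reachable_packing[OF F F0 assms] by (auto simp: size_def)
    have Fi: "F i \<subseteq> E" "indep (F i)" using packingD[OF pack] i by blast+
    have fin: "finite (F i)" using Fi(1) assms by (rule finite_subset)
    have eFi: "e \<notin> F i" using e i by blast
    \<comment> \<open>Otherwise adding \<open>e\<close> to \<open>F i\<close> would enlarge a
      packing of maximal size.\<close>
    have eF: "e \<in> cl (F i)"
    proof (rule ccontr)
      assume "e \<notin> cl (F i)"
      then have "size (F(i := insert e (F i))) \<le> size F"
        using max[OF packing_update[OF pack i e order_refl]] size by simp
      then show False
        using sum_card_update[OF i, of F "insert e (F i)"] card_insert_disjoint[OF fin eFi]
        unfolding size_def by linarith
    qed
    \<comment> \<open>If \<open>e\<close> needed \<open>f\<close>, swapping the two would leave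
      \<open>f\<close> uncovered, so \<open>f\<close> would belong to \<open>A\<close>. Hence the
      fundamental circuit of \<open>e\<close> uses only elements of \<open>F i\<close> in
      \<open>A\<close>.\<close>
    have "e \<in> cl (F i - {f})" if f: "f \<in> F i - A" for f
    proof (rule ccontr)
      let ?F = "F(i := insert e (F i - {f}))"
      assume "e \<notin> cl (F i - {f})"
      then have "exchange_reachable E m F0 ?F"
        using f by (intro swap[OF F i e]) auto
      moreover have "f \<notin> (\<Union>j<m. ?F j)"
      proof -
        have "f \<notin> F j" if "j < m" "j \<noteq> i" for j
          using packingD(3)[OF pack i that(1)] f that by blast
        moreover have "f \<noteq> e" using f eFi by blast
        ultimately show ?thesis by auto
      qed
      ultimately have "f \<in> A" using Fi(1) f unfolding A_def by blast
      then show False using f by simp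
    qed
    then have "e \<in> cl (F i - (F i - A))"
      by (rule cl_Diff_indep[OF Fi(2) finite_Diff[OF fin] Diff_subset eF])
    then show ?thesis unfolding Diff_Diff_Int .
  qed
  \<comment> \<open>Spans found in a later packing are pulled back to \<open>F0\<close>: the
    incoming element of a swap is already spanned by the old member within \<open>A\<close>, so this
    span never grows.\<close>
  have invariant: "cl (F i \<inter> A) \<subseteq> cl (F0 i \<inter> A)"
    if "exchange_reachable E m F0 F" "i < m" for F i
    using that(1)
  proof induction
    case start
    then show ?case by simp
  next
    case (swap F j e f)
    show ?case
    proof (cases "i = j")
      case True
      have "insert e (F j - {f}) \<inter> A \<subseteq> cl (F j \<inter> A)"
        using uncovered[OF swap.hyps(1,3,2)] extensive[of "F j \<inter> A"] by auto
      then have "cl ((F(j := insert e (F j - {f}))) i \<inter> A) \<subseteq> cl (F i \<inter> A)"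
        unfolding True fun_upd_same by (rule cl_least)
      then show ?thesis using swap.IH by (rule subset_trans)
    next
      case False
      then show ?thesis using swap.IH by simp
    qed
  qed
  have "A \<subseteq> cl (F0 i \<inter> A)" if i: "i < m" for i
  proof
    fix e assume "e \<in> A"
    then obtain F where F: "exchange_reachable E m F0 F" "e \<in> E - (\<Union>j<m. F j)"
      unfolding A_def by blast
    show "e \<in> cl (F0 i \<inter> A)"
      using uncovered[OF F i] invariant[OF F(1) i] by (rule subsetD[rotated])
  qed
  moreover have "E - A \<subseteq> (\<Union>i<m. F0 i)"
    using start[of E m F0] unfolding A_def by blast
  moreover have "A \<subseteq> E" unfolding A_def by blast
  ultimately show ?thesis using F0 by (intro that) auto
qed

end

section \<open>Packing spanning connected subgraphs\<close>

text \<open>The closure operator of the cycle matroid, with edges given as pairs in either orientation.\<close>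

definition eqvcl :: "('a \<times> 'a) set \<Rightarrow> ('a \<times> 'a) set" where
  "eqvcl R = (symcl R)\<^sup>*"

lemma equiv_eqvcl: "equiv UNIV (eqvcl R)"
  unfolding eqvcl_def
proof (rule equivI)
  show "sym ((symcl R)\<^sup>*)"
    by (intro sym_rtrancl) (auto simp: sym_def symcl_def)
qed (auto simp: refl_on_def trans_rtrancl)

lemma eqvcl_least:
  assumes "equiv UNIV S" "R \<subseteq> S"
  shows "eqvcl R \<subseteq> S"
proof (rule subrelI)
  fix x y assume "(x, y) \<in> eqvcl R"
  then show "(x, y) \<in> S"
    unfolding eqvcl_def
  proof (induction rule: rtrancl_induct)
    case base
    then show ?case using assms(1) by (auto elim!: equivE simp: refl_on_def)
  next
    case (step y z)
    then have "(y, z) \<in> S"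
      using assms by (auto simp: symcl_def elim!: equivE dest: symD)
    then show ?case using step.IH assms(1) by (auto elim!: equivE dest: transD)
  qed
qed

lemma eqvcl_extensive: "R \<subseteq> eqvcl R"
  by (auto simp: eqvcl_def symcl_def)

lemma eqvcl_mono: "R \<subseteq> S \<Longrightarrow> eqvcl R \<subseteq> eqvcl S"
  by (intro eqvcl_least equiv_eqvcl) (use eqvcl_extensive in blast)

lemma eqvcl_refl: "(x, x) \<in> eqvcl R"
  and eqvcl_sym: "(x, y) \<in> eqvcl R \<Longrightarrow> (y, x) \<in> eqvcl R"
  and eqvcl_trans: "(x, y) \<in> eqvcl R \<Longrightarrow> (y, z) \<in> eqvcl R \<Longrightarrow> (x, z) \<in> eqvcl R"
  using equiv_eqvcl[of R] by (auto elim!: equivE simp: refl_on_def dest: symD transD)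

text \<open>A path either avoids the new edge or can be taken to cross it once, in one of two
  directions. Formally, the right-hand side is itself an equivalence relation containing the
  generators.\<close>

lemma eqvcl_insert:
  assumes "(x, y) \<in> eqvcl (insert (p, q) R)"
  shows "(x, y) \<in> eqvcl R \<or> (x, p) \<in> eqvcl R \<and> (q, y) \<in> eqvcl R
    \<or> (x, q) \<in> eqvcl R \<and> (p, y) \<in> eqvcl R"
proof -
  let ?S = "{(x, y). (x, y) \<in> eqvcl R \<or> (x, p) \<in> eqvcl R \<and> (q, y) \<in> eqvcl R
    \<or> (x, q) \<in> eqvcl R \<and> (p, y) \<in> eqvcl R}"
  have "equiv UNIV ?S"
  proof (rule equivI)
    show "refl_on UNIV ?S" by (auto simp: refl_on_def eqvcl_refl)
    show "sym ?S" by (rule symI) (auto dest: eqvcl_sym)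
    show "trans ?S"
      by (rule transI, unfold mem_Collect_eq case_prod_conv) (meson eqvcl_sym eqvcl_trans)
  qed auto
  moreover have "insert (p, q) R \<subseteq> ?S"
    using eqvcl_extensive[of R] by (auto simp: eqvcl_refl)
  ultimately show ?thesis using eqvcl_least[of ?S "insert (p, q) R"] assms by auto
qed

text \<open>For exchange, a connection from \<open>x\<close> to \<open>y\<close> that appears only
  with \<open>(p, q)\<close> must run through it; its two remaining pieces together with
  \<open>(x, y)\<close> join \<open>p\<close> to \<open>q\<close>.\<close>

interpretation eqvcl: closure_operator eqvcl
proof
  show "A \<subseteq> eqvcl A" for A :: "('a \<times> 'a) set" by (rule eqvcl_extensive)
  show "eqvcl A \<subseteq> eqvcl B" if "A \<subseteq> B" for A B :: "('a \<times> 'a) set" using that by (rule eqvcl_mono)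
  show "eqvcl (eqvcl A) \<subseteq> eqvcl A" for A :: "('a \<times> 'a) set"
    by (rule eqvcl_least[OF equiv_eqvcl order_refl])
  show "e \<in> eqvcl (insert f A)" if "f \<in> eqvcl (insert e A)" "f \<notin> eqvcl A"
    for e f and A :: "('a \<times> 'a) set"
  proof -
    obtain x y p q where ef: "f = (x, y)" "e = (p, q)" by (cases e; cases f) auto
    let ?B = "insert (x, y) A"
    have up: "eqvcl A \<subseteq> eqvcl ?B" by (rule eqvcl_mono) auto
    have xy: "(x, y) \<in> eqvcl ?B" using eqvcl_extensive[of ?B] by auto
    have "(x, p) \<in> eqvcl A \<and> (q, y) \<in> eqvcl A \<or> (x, q) \<in> eqvcl A \<and> (p, y) \<in> eqvcl A"
      using eqvcl_insert[of x y p q A] that unfolding ef by simp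
    then have "(x, p) \<in> eqvcl ?B \<and> (q, y) \<in> eqvcl ?B \<or> (x, q) \<in> eqvcl ?B \<and> (p, y) \<in> eqvcl ?B"
      using up by blast
    then have "(p, q) \<in> eqvcl ?B"
    proof (elim disjE conjE)
      assume "(x, p) \<in> eqvcl ?B" "(q, y) \<in> eqvcl ?B"
      then show ?thesis using eqvcl_trans[OF eqvcl_sym eqvcl_trans[OF xy eqvcl_sym]] by blast
    next
      assume "(x, q) \<in> eqvcl ?B" "(p, y) \<in> eqvcl ?B"
      then show ?thesis using eqvcl_trans[OF _ eqvcl_trans[OF eqvcl_sym[OF xy]]] by blast
    qed
    then show ?thesis unfolding ef .
  qed
qed

text \<open>Some link of the chain from \<open>x\<close> to \<open>y\<close> leaves
  \<open>X\<close>; pairs may be traversed backwards, hence the disjunction.\<close>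

lemma eqvcl_cut:
  assumes "(x, y) \<in> eqvcl R" "x \<in> X" "y \<notin> X"
  obtains a b where "(a, b) \<in> R \<or> (b, a) \<in> R" "a \<in> X" "b \<notin> X"
proof -
  have "\<exists>a b. (a, b) \<in> symcl R \<and> a \<in> X \<and> b \<notin> X"
    using assms unfolding eqvcl_def by (induction rule: rtrancl_induct) auto
  then show ?thesis using that by (auto simp: symcl_def)
qed

lemma eqvcl_class_eq: "eqvcl R `` {x} = eqvcl R `` {y} \<longleftrightarrow> (x, y) \<in> eqvcl R"
  by (rule eq_equiv_class_iff[OF equiv_eqvcl UNIV_I UNIV_I])

text \<open>The classes of \<open>a\<close> and \<open>b\<close> merge, so the new classes are
  already obtained from the old ones other than that of \<open>b\<close>.\<close>

lemma card_quotient_eqvcl_insert: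
  assumes "finite V" "a \<in> V" "b \<in> V" "(a, b) \<notin> eqvcl R"
  shows "card (V // eqvcl (insert (a, b) R)) < card (V // eqvcl R)"
proof -
  let ?R = "eqvcl R" and ?S = "eqvcl (insert (a, b) R)"
  have RS: "?R \<subseteq> ?S" by (rule eqvcl_mono) auto
  have ab: "(a, b) \<in> ?S" using eqvcl_extensive[of "insert (a, b) R"] by auto
  have cls: "?S `` (?R `` {x}) = ?S `` {x}" for x
  proof (intro equalityI subsetI)
    fix z assume "z \<in> ?S `` (?R `` {x})"
    then obtain y where "(x, y) \<in> ?R" "(y, z) \<in> ?S" by blast
    then have "(x, z) \<in> ?S" using eqvcl_trans[of x y _ z] RS by blast
    then show "z \<in> ?S `` {x}" by simp
  next
    fix z assume "z \<in> ?S `` {x}"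
    then show "z \<in> ?S `` (?R `` {x})" using eqvcl_refl[of x R] by blast
  qed
  have fin: "finite (V // ?R)" using assms(1) by (simp add: quotient_def)
  have "V // ?S \<subseteq> (\<lambda>C. ?S `` C) ` (V // ?R - {?R `` {b}})"
  proof
    fix D assume "D \<in> V // ?S"
    then obtain x where x: "x \<in> V" "D = ?S `` {x}" by (rule quotientE)
    \<comment> \<open>A point in the old class of \<open>b\<close> is represented by
      \<open>a\<close> instead, which has the same new class.\<close>
    define y where "y = (if (x, b) \<in> ?R then a else x)"
    have "y \<in> V" using x assms y_def by simp
    moreover have "?R `` {y} \<noteq> ?R `` {b}"
      unfolding eqvcl_class_eq using assms(4) by (simp add: y_def)
    moreover have "D = ?S `` {y}"
    proof (cases "(x, b) \<in> ?R")
      case True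
      then have "(x, b) \<in> ?S" using RS by blast
      then have "(x, a) \<in> ?S" using eqvcl_sym[OF ab] by (rule eqvcl_trans)
      then show ?thesis using x(2) True by (simp add: y_def eqvcl_class_eq)
    qed (simp add: x(2) y_def)
    ultimately show "D \<in> (\<lambda>C. ?S `` C) ` (V // ?R - {?R `` {b}})"
      using cls[of y] by (auto intro!: image_eqI[of _ _ "?R `` {y}"] quotientI)
  qed
  then have "card (V // ?S) \<le> card (V // ?R - {?R `` {b}})"
    by (rule surj_card_le[rotated]) (simp add: fin)
  also have "\<dots> < card (V // ?R)"
    using fin quotientI[OF assms(3)] by (rule card_Diff1_less)
  finally show ?thesis .
qed

text \<open>The rank count for a set \<open>B\<close> that is independent over \<open>A\<close>:
  adding its pairs one at a time, each merges two classes.\<close>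

lemma card_quotient_eqvcl_Un:
  assumes "finite V" "finite B" "B \<subseteq> V \<times> V" "\<And>e. e \<in> B \<Longrightarrow> e \<notin> eqvcl (A \<union> (B - {e}))"
  shows "card B + card (V // eqvcl (A \<union> B)) \<le> card (V // eqvcl A)"
  using assms(2-4)
proof (induction B)
  case empty
  then show ?case by simp
next
  case (insert e B)
  have "f \<notin> eqvcl (A \<union> (B - {f}))" if "f \<in> B" for f
    using insert.prems(2)[of f] that eqvcl_mono[of "A \<union> (B - {f})" "A \<union> (insert e B - {f})"] by auto
  then have IH: "card B + card (V // eqvcl (A \<union> B)) \<le> card (V // eqvcl A)"
    using insert by auto
  have "e \<notin> eqvcl (A \<union> B)"
    using insert.prems(2)[of e] insert.hyps(2) by simp
  then have "card (V // eqvcl (A \<union> insert e B)) < card (V // eqvcl (A \<union> B))"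
    using card_quotient_eqvcl_insert[OF assms(1), of "fst e" "snd e" "A \<union> B"] insert.prems(1) by auto
  then show ?case using IH insert.hyps by simp
qed

text \<open>The easily applied case of the Nash-Williams and Tutte tree packing theorem.
  Non-spanning would yield contradictory bounds on the number of pairs outside the tight set
  \<open>A\<close>.\<close>

theorem edge_disjoint_spanning_packing:
  assumes "finite V" "E \<subseteq> V \<times> V"
    and cut: "\<And>C. C \<subset> V \<Longrightarrow> C \<noteq> {} \<Longrightarrow> 2 * m \<le> card {(x, y) \<in> E. (x \<in> C) \<noteq> (y \<in> C)}"
  obtains F where "\<And>i. i < m \<Longrightarrow> F i \<subseteq> E" "\<And>i j. i < m \<Longrightarrow> j < m \<Longrightarrow> i \<noteq> j \<Longrightarrow> F i \<inter> F j = {}"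
    and "\<And>i. i < m \<Longrightarrow> V \<times> V \<subseteq> eqvcl (F i)"
proof -
  have finE: "finite E" using assms(1,2) finite_subset by blast
  obtain F A where F: "eqvcl.packing E m F" and A: "A \<subseteq> E" "E - A \<subseteq> (\<Union>i<m. F i)"
    and cl: "\<And>i. i < m \<Longrightarrow> A \<subseteq> eqvcl (F i \<inter> A)"
    using eqvcl.maximal_packing_tight_set[OF finE] by metis
  have "V \<times> V \<subseteq> eqvcl (F i)" if i: "i < m" for i
  proof (rule ccontr)
    assume not: "\<not> V \<times> V \<subseteq> eqvcl (F i)"
    let ?P = "V // eqvcl A"
    have finP: "finite ?P" using assms(1) by (simp add: quotient_def)
    have "V \<noteq> {}" using not by auto
    have AV: "A \<subseteq> V \<times> V" using A(1) assms(2) by blast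
    \<comment> \<open>\<open>F j\<close> spans \<open>A\<close> within \<open>A\<close>, so
      \<open>F j - A\<close> is independent over \<open>A\<close>; at least one class remains,
      whence the strict inequality.\<close>
    have small: "card (F j - A) < card ?P" if j: "j < m" for j
    proof -
      note Fj = eqvcl.packingD(1,2)[OF F j]
      have "e \<notin> eqvcl (A \<union> ((F j - A) - {e}))" if "e \<in> F j - A" for e
      proof
        assume e: "e \<in> eqvcl (A \<union> ((F j - A) - {e}))"
        have "A \<union> ((F j - A) - {e}) \<subseteq> eqvcl (F j - {e})"
          using cl[OF j] eqvcl_mono[of "F j \<inter> A" "F j - {e}"] eqvcl_extensive[of "F j - {e}"] that
          by blast
        then have "e \<in> eqvcl (F j - {e})" using e eqvcl.cl_least by blast
        then show False using Fj(2) that by (auto simp: eqvcl.indep_def)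
      qed
      moreover have "finite (F j - A)" "F j - A \<subseteq> V \<times> V"
        using finite_subset[OF Fj(1) finE] Fj(1) assms(2) by auto
      ultimately have "card (F j - A) + card (V // eqvcl (A \<union> (F j - A))) \<le> card ?P"
        by (intro card_quotient_eqvcl_Un assms(1)) auto
      moreover have "card (V // eqvcl (A \<union> (F j - A))) > 0"
        using assms(1) \<open>V \<noteq> {}\<close> by (simp add: card_gt_0_iff quotient_def)
      ultimately show ?thesis by linarith
    qed
    have "E - A \<subseteq> (\<Union>j<m. F j - A)" using A(2) by blast
    moreover have "finite (\<Union>j<m. F j - A)"
      using finite_subset[OF eqvcl.packingD(1)[OF F] finE] by blast
    ultimately have "card (E - A) \<le> card (\<Union>j<m. F j - A)" by (rule card_mono[rotated])
    also have "\<dots> \<le> (\<Sum>j<m. card (F j - A))" by (rule card_UN_le) simp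
    \<comment> \<open>The index \<open>i\<close> witnesses that the sum is not empty, as strictness
      requires.\<close>
    also have "\<dots> < (\<Sum>j<m. card ?P)"
      using i small by (intro sum_strict_mono) auto
    finally have less: "card (E - A) < m * card ?P" by simp
    let ?cut = "\<lambda>C. {(x, y) \<in> E. (x \<in> C) \<noteq> (y \<in> C)}"
    \<comment> \<open>Classes stay inside \<open>V\<close> because \<open>A\<close> does. A single
      class equal to \<open>V\<close> would make \<open>F i\<close>, which spans \<open>A\<close>,
      connect all of \<open>V\<close>.\<close>
    have cls: "C \<subset> V \<and> C \<noteq> {} \<and> ?cut C \<subseteq> E - A" if "C \<in> ?P" for C
    proof -
      obtain x where x: "x \<in> V" "C = eqvcl A `` {x}" using \<open>C \<in> ?P\<close> by (rule quotientE)
      have "y \<in> V" if "(x, y) \<in> eqvcl A" for y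
        using that x(1) AV eqvcl_cut[of x y A V] by blast
      then have "C \<subseteq> V" using x(2) by blast
      moreover have "C \<noteq> V"
      proof
        assume CV: "C = V"
        have "eqvcl A \<subseteq> eqvcl (F i)"
          using cl[OF i] eqvcl.cl_least eqvcl_mono[of "F i \<inter> A" "F i"] by blast
        moreover have "V \<times> V \<subseteq> eqvcl A"
        proof safe
          fix y z assume "y \<in> V" "z \<in> V"
          then have "(x, y) \<in> eqvcl A" "(x, z) \<in> eqvcl A" using x(2) unfolding CV by blast+
          then show "(y, z) \<in> eqvcl A" by (meson eqvcl_sym eqvcl_trans)
        qed
        ultimately show False using not by blast
      qed
      moreover have "x \<in> C" using x by (simp add: eqvcl_refl)
      moreover have "(a \<in> C) = (b \<in> C)" if "(a, b) \<in> A" for a b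
      proof -
        have "(a, b) \<in> eqvcl A" using that eqvcl_extensive by (rule subsetD[rotated])
        then have "(x, a) \<in> eqvcl A \<longleftrightarrow> (x, b) \<in> eqvcl A"
          using eqvcl_sym eqvcl_trans by metis
        then show ?thesis unfolding x(2) by simp
      qed
      ultimately show ?thesis by auto
    qed
    \<comment> \<open>Double counting of classes and the pairs crossing their boundaries: a pair
      outside \<open>A\<close> crosses at most two, those of the classes of its ends.\<close>
    have "2 * m * card ?P = (\<Sum>C\<in>?P. 2 * m)" by simp
    also have "\<dots> \<le> (\<Sum>C\<in>?P. card (?cut C))"
      using cls cut by (intro sum_mono) blast
    also have "\<dots> = (\<Sum>C\<in>?P. card {e \<in> E - A. e \<in> ?cut C})"
      using cls by (intro sum.cong refl arg_cong[where f = card]) blast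
    also have "\<dots> = (\<Sum>e\<in>E - A. card {C \<in> ?P. e \<in> ?cut C})"
      using finP finE by (intro sum_multicount_gen) auto
    also have "\<dots> \<le> (\<Sum>e\<in>E - A. 2)"
    proof (rule sum_mono)
      fix e assume "e \<in> E - A"
      have "{C \<in> ?P. e \<in> ?cut C} \<subseteq> {eqvcl A `` {fst e}, eqvcl A `` {snd e}}"
      proof
        fix C assume C: "C \<in> {C \<in> ?P. e \<in> ?cut C}"
        then obtain x where x: "C = eqvcl A `` {x}" by (auto elim: quotientE)
        have "fst e \<in> C \<or> snd e \<in> C" using C by auto
        then show "C \<in> {eqvcl A `` {fst e}, eqvcl A `` {snd e}}"
          using eqvcl_class_eq[of A x] unfolding x by auto
      qed
      then have "card {C \<in> ?P. e \<in> ?cut C} \<le> card {eqvcl A `` {fst e}, eqvcl A `` {snd e}}"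
        by (intro card_mono) auto
      also have "\<dots> \<le> 2" by (simp add: card_insert_if)
      finally show "card {C \<in> ?P. e \<in> ?cut C} \<le> 2" .
    qed
    also have "\<dots> = 2 * card (E - A)" by simp
    finally show False using less by simp
  qed
  then show ?thesis using eqvcl.packingD(1,3)[OF F] by (rule that[rotated 2])
qed

section \<open>Minors from bags\<close>

text \<open>Connectivity in terms of cuts, a form that survives images and contractions.\<close>

definition connected_on :: "('a \<times> 'a) set \<Rightarrow> 'a set \<Rightarrow> bool" where
  "connected_on R B \<longleftrightarrow> (\<forall>X\<subseteq>B. X \<noteq> {} \<longrightarrow> X \<noteq> B \<longrightarrow> (\<exists>x\<in>X. \<exists>y\<in>B - X. (x, y) \<in> R))"

lemma connected_onI:
  assumes "\<And>X x y. X \<subseteq> B \<Longrightarrow> x \<in> X \<Longrightarrow> y \<in> B - X \<Longrightarrow> \<exists>a\<in>X. \<exists>b\<in>B - X. (a, b) \<in> R"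
  shows "connected_on R B"
  unfolding connected_on_def using assms by blast

lemma connected_onE:
  assumes "connected_on R B" "X \<subseteq> B" "x \<in> X" "y \<in> B - X"
  obtains a b where "a \<in> X" "b \<in> B - X" "(a, b) \<in> R"
  using assms unfolding connected_on_def by blast

lemma connected_induce_subgraph_imp_connected_on:
  assumes "pair_graph G" "Digraph_Component.connected (with_proj G \<restriction> W)"
  shows "connected_on (parcs G) W"
proof (rule connected_onI)
  fix X x y assume X: "X \<subseteq> W" "x \<in> X" "y \<in> W - X"
  let ?M = "mk_symmetric (with_proj G \<restriction> W)"
  have M: "parcs ?M \<subseteq> parcs G \<inter> W \<times> W"
    using pair_graphD(3)[OF assms(1)] by (auto simp: mk_symmetric_def)
  have "(x, y) \<in> rtrancl_on W (parcs ?M)"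
    using assms(2) X
    by (auto simp: Digraph_Component.connected_def strongly_connected_def reachable_def)
  \<comment> \<open>Generalized for induction along the walk: it is still in \<open>X\<close> or has
    crossed the boundary at some arc.\<close>
  then have "y \<in> X \<or> (\<exists>a\<in>X. \<exists>b\<in>W - X. (a, b) \<in> parcs ?M)"
  proof (induction rule: rtrancl_on_induct)
    case base
    then show ?case using X(2) by simp
  next
    case (step y z)
    then show ?case by blast
  qed
  then show "\<exists>a\<in>X. \<exists>b\<in>W - X. (a, b) \<in> parcs G" using X(3) M by blast
qed

section \<open>Models of complete graphs and their reduction to minors\<close>

lemma has_minor_step: "minor_step G G' \<Longrightarrow> has_minor G' H \<Longrightarrow> has_minor G H"
  unfolding has_minor_def by (meson converse_rtranclp_into_rtranclp)

text \<open>The bags are the branch sets of a model of the complete graph on \<open>n\<close>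
  vertices. They need not cover \<open>T\<close>.\<close>

definition complete_bags :: "'a pair_pre_digraph \<Rightarrow> nat \<Rightarrow> (nat \<Rightarrow> 'a set) \<Rightarrow> bool" where
  "complete_bags T n B \<longleftrightarrow>
    (\<forall>i<n. B i \<subseteq> pverts T \<and> B i \<noteq> {} \<and> connected_on (parcs T) (B i)) \<and>
    (\<forall>i<n. \<forall>j<n. i \<noteq> j \<longrightarrow> B i \<inter> B j = {} \<and> (\<exists>x\<in>B i. \<exists>y\<in>B j. (x, y) \<in> parcs T))"

lemma complete_bagsD:
  assumes "complete_bags T n B"
  shows "i < n \<Longrightarrow> B i \<subseteq> pverts T" "i < n \<Longrightarrow> B i \<noteq> {}"
    and "i < n \<Longrightarrow> connected_on (parcs T) (B i)"
    and "i < n \<Longrightarrow> j < n \<Longrightarrow> i \<noteq> j \<Longrightarrow> B i \<inter> B j = {}"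
    and "i < n \<Longrightarrow> j < n \<Longrightarrow> i \<noteq> j \<Longrightarrow> \<exists>x\<in>B i. \<exists>y\<in>B j. (x, y) \<in> parcs T"
  using assms unfolding complete_bags_def by metis+

lemma complete_bagsI:
  assumes "\<And>i. i < n \<Longrightarrow> B i \<subseteq> pverts T" "\<And>i. i < n \<Longrightarrow> B i \<noteq> {}"
    and "\<And>i. i < n \<Longrightarrow> connected_on (parcs T) (B i)"
    and "\<And>i j. i < n \<Longrightarrow> j < n \<Longrightarrow> i \<noteq> j \<Longrightarrow> B i \<inter> B j = {}"
    and "\<And>i j. i < n \<Longrightarrow> j < n \<Longrightarrow> i \<noteq> j \<Longrightarrow> \<exists>x\<in>B i. \<exists>y\<in>B j. (x, y) \<in> parcs T"
  shows "complete_bags T n B"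
  unfolding complete_bags_def using assms by metis

lemma complete_bags_delete_vertex:
  assumes bags: "complete_bags T n B" and v: "v \<notin> (\<Union>i<n. B i)"
  shows "complete_bags (delete_vertex v T) n B"
proof (rule complete_bagsI)
  note B = complete_bagsD[OF bags]
  let ?T = "delete_vertex v T"
  have arcs: "(x, y) \<in> parcs ?T" if "(x, y) \<in> parcs T" "x \<in> B i" "y \<in> B j" "i < n" "j < n" for x y i j
    using that v by (auto simp: delete_vertex_def)
  show "B i \<subseteq> pverts ?T" if "i < n" for i
    using B(1)[OF that] v that by (auto simp: delete_vertex_def)
  show "connected_on (parcs ?T) (B i)" if i: "i < n" for i
  proof (rule connected_onI)
    fix X x y assume X: "X \<subseteq> B i" "x \<in> X" "y \<in> B i - X"
    obtain a b where "a \<in> X" "b \<in> B i - X" "(a, b) \<in> parcs T"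
      using B(3)[OF i] X by (rule connected_onE)
    then show "\<exists>a\<in>X. \<exists>b\<in>B i - X. (a, b) \<in> parcs ?T"
      using arcs[of a b i i] X(1) i by blast
  qed
  show "\<exists>x\<in>B i. \<exists>y\<in>B j. (x, y) \<in> parcs ?T" if "i < n" "j < n" "i \<noteq> j" for i j
    using B(5)[OF that] arcs that(1,2) by blast
qed (use complete_bagsD[OF bags] in blast)+

text \<open>Both ends lie in one bag and the merged vertex is called \<open>u\<close>, so the only
  change to the bags is the loss of \<open>v\<close>.\<close>

lemma complete_bags_contract_edge:
  assumes bags: "complete_bags T n B" and "i < n" "u \<in> B i" "v \<in> B i" "u \<noteq> v"
  shows "complete_bags (contract_edge u v T) n (\<lambda>j. B j - {v})"
proof (rule complete_bagsI)
  note B = complete_bagsD[OF bags]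
  let ?T = "contract_edge u v T"
  define r where "r x = (if x = v then u else x)" for x
  have T: "pverts ?T = r ` pverts T"
    "parcs ?T = {(r x, r y) | x y. (x, y) \<in> parcs T \<and> r x \<noteq> r y}"
    by (auto simp: contract_edge_def r_def)
  have r: "r x \<in> B j - {v}" if "x \<in> B j" "j < n" for x j
    using B(4)[OF \<open>i < n\<close> that(2)] that assms by (cases "j = i") (auto simp: r_def)
  have r_id: "r x = x" if "x \<in> B j - {v}" for x j
    using that by (simp add: r_def)
  show "B j - {v} \<subseteq> pverts ?T" if "j < n" for j
  proof
    fix x assume "x \<in> B j - {v}"
    then have "x = r x" "x \<in> pverts T" using B(1)[OF that] r_id by auto
    then show "x \<in> pverts ?T" unfolding T(1) by (rule image_eqI)
  qed
  show "B j - {v} \<noteq> {}" if "j < n" for j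
    using r[OF _ that] B(2)[OF that] by blast
  show "connected_on (parcs ?T) (B j - {v})" if j: "j < n" for j
  proof (rule connected_onI)
    fix X x y assume X: "X \<subseteq> B j - {v}" "x \<in> X" "y \<in> B j - {v} - X"
    \<comment> \<open>Pulling the cut back along \<open>r\<close> puts \<open>u\<close> and
      \<open>v\<close> on the same side, so the crossing arc found in \<open>T\<close> is not
      contracted.\<close>
    let ?Y = "{z \<in> B j. r z \<in> X}"
    have "r x = x" "r y = y" using X by (auto intro: r_id[of _ j])
    then have Y: "?Y \<subseteq> B j" "x \<in> ?Y" "y \<in> B j - ?Y" using X by auto
    obtain a b where ab: "a \<in> ?Y" "b \<in> B j - ?Y" "(a, b) \<in> parcs T"
      using B(3)[OF j] Y by (rule connected_onE)
    have rab: "r a \<in> X" "r b \<in> B j - {v} - X" using ab(1,2) r[OF _ j, of b] by simp_all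
    then have "r a \<noteq> r b" by (metis DiffD2)
    then have "(r a, r b) \<in> parcs ?T" using ab(3) unfolding T(2) by blast
    then show "\<exists>a\<in>X. \<exists>b\<in>B j - {v} - X. (a, b) \<in> parcs ?T" using rab by blast
  qed
  show "(B j - {v}) \<inter> (B l - {v}) = {}" if "j < n" "l < n" "j \<noteq> l" for j l
    using B(4)[OF that] by blast
  show "\<exists>x\<in>B j - {v}. \<exists>y\<in>B l - {v}. (x, y) \<in> parcs ?T" if jl: "j < n" "l < n" "j \<noteq> l" for j l
  proof -
    obtain x y where xy: "x \<in> B j" "y \<in> B l" "(x, y) \<in> parcs T" using B(5)[OF jl] by blast
    have rx: "r x \<in> B j - {v}" "r y \<in> B l - {v}"
      using r[OF xy(1) jl(1)] r[OF xy(2) jl(2)] .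
    then have "r x \<noteq> r y" using B(4)[OF jl] by (metis DiffD1 disjoint_iff)
    then have "(r x, r y) \<in> parcs ?T" using xy(3) unfolding T(2) by blast
    then show ?thesis using rx by (intro bexI)
  qed
qed

text \<open>Each step removes one vertex: delete one outside the bags, or contract an edge inside a
  bag with at least two elements. When neither is possible, the bags are singletons covering
  \<open>T\<close>, which is then complete.\<close>

theorem has_minor_complete_graph_if_bags:
  assumes "pair_graph T" "complete_bags T n B"
  shows "has_minor T (complete_graph n)"
  using assms
proof (induction "card (pverts T)" arbitrary: T B rule: less_induct)
  case less
  note T = pair_graphD[OF less.prems(1)]
  note B = complete_bagsD[OF less.prems(2)]
  have step: "has_minor T (complete_graph n)"
    if "minor_step T T'" "complete_bags T' n B'" "pverts T' = pverts T - {v}" "v \<in> pverts T" for T' B' v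
  proof -
    have "card (pverts T') < card (pverts T)"
      unfolding that(3) using T(1) that(4) by (rule card_Diff1_less)
    then have "has_minor T' (complete_graph n)"
      using pair_graph_minor_step[OF that(1) less.prems(1)] that(2) by (rule less.hyps)
    with that(1) show ?thesis by (rule has_minor_step)
  qed
  consider (outside) v where "v \<in> pverts T" "v \<notin> (\<Union>i<n. B i)"
    | (large) i x where "i < n" "x \<in> B i" "B i \<noteq> {x}"
    | (small) "pverts T = (\<Union>i<n. B i)" "\<forall>i<n. \<exists>b. B i = {b}"
  proof -
    have "(\<Union>i<n. B i) \<subseteq> pverts T" using B(1) by (intro UN_least) simp
    moreover have "\<exists>x. x \<in> B i" if "i < n" for i using B(2)[OF that] by (simp add: ex_in_conv)
    ultimately show thesis using outside large small by (metis subsetI subset_antisym)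
  qed
  then show ?case
  proof cases
    case outside
    show ?thesis
    proof (rule step)
      show "minor_step T (delete_vertex v T)" using outside(1) by (rule minor_step.delete_vertex)
      show "complete_bags (delete_vertex v T) n B"
        using less.prems(2) outside(2) by (rule complete_bags_delete_vertex)
      show "pverts (delete_vertex v T) = pverts T - {v}" by (simp add: delete_vertex_def)
    qed (rule outside(1))
  next
    case large
    then obtain y where "y \<in> B i - {x}" by blast
    \<comment> \<open>Connectedness of the bag, tested on the cut \<open>{x}\<close>, supplies a
      neighbour of \<open>x\<close> inside it.\<close>
    then obtain v where v: "v \<in> B i" "(x, v) \<in> parcs T"
      using connected_onE[OF B(3)[OF large(1)], of "{x}" x y] large(2) by blast
    have xv: "x \<noteq> v" using T(4)[OF v(2)] .
    have V: "x \<in> pverts T" "v \<in> pverts T" using B(1)[OF large(1)] large(2) v(1) by blast+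
    show ?thesis
    proof (rule step)
      show "minor_step T (contract_edge x v T)" using v(2) by (rule minor_step.contract_edge)
      show "complete_bags (contract_edge x v T) n (\<lambda>j. B j - {v})"
        using less.prems(2) large(1,2) v(1) xv by (rule complete_bags_contract_edge)
      show "pverts (contract_edge x v T) = pverts T - {v}"
        using V xv by (auto simp: contract_edge_def Let_def)
    qed (rule V(2))
  next
    case small
    then obtain b where b: "\<And>i. i < n \<Longrightarrow> B i = {b i}" by metis
    have inj: "inj_on b {..<n}"
      using B(4) b by (intro inj_onI) (metis insert_disjoint(1) lessThan_iff singletonI)
    have adj: "(b i, b j) \<in> parcs T" if "i < n" "j < n" "i \<noteq> j" for i j
      using B(5)[OF that] b that by simp
    have verts: "pverts T = b ` {..<n}" using small(1) b by auto
    let ?K = "complete_graph n"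
    let ?f = "\<lparr>iso_verts = b, iso_arcs = map_prod b b, iso_head = snd, iso_tail = fst\<rparr>"
    have "parcs T = map_prod b b ` parcs ?K"
    proof
      show "parcs T \<subseteq> map_prod b b ` parcs ?K"
      proof (rule subrelI)
        fix x y assume xy: "(x, y) \<in> parcs T"
        then have "x \<in> b ` {..<n}" "y \<in> b ` {..<n}" using T(2) verts by auto
        then obtain i j where ij: "i < n" "j < n" "x = b i" "y = b j" by auto
        moreover have "i \<noteq> j" using T(4)[OF xy] ij by blast
        ultimately show "(x, y) \<in> map_prod b b ` parcs ?K"
          by (intro image_eqI[of _ _ "(i, j)"]) (auto simp: complete_graph_def)
      qed
    qed (use adj in \<open>auto simp: complete_graph_def\<close>)
    then have "with_proj T = app_iso ?f (with_proj ?K)"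
      using verts by (simp add: app_iso_def with_proj_def complete_graph_def)
    moreover have "wf_digraph (with_proj ?K)"
      by unfold_locales (auto simp: complete_graph_def)
    moreover have "inj_on (map_prod b b) (parcs ?K)"
      using map_prod_inj_on[OF inj inj] by (rule inj_on_subset) (auto simp: complete_graph_def)
    ultimately have "digraph_iso (with_proj ?K) (with_proj T)"
      unfolding digraph_iso_def
      using inj by (intro exI[of _ ?f]) (simp add: pre_digraph.digraph_isomorphism_def complete_graph_def)
    then show ?thesis unfolding has_minor_def by blast
  qed
qed

section \<open>Bags in the total graph\<close>

text \<open>Deleting everything except \<open>v\<close> leaves a single vertex, which counts as a
  failure of connectivity, so that deletion set has at least \<open>Suc d\<close> elements.\<close>

lemma card_verts_ge_vertex_connected:
  assumes "pair_graph G" "vertex_connected (Suc d) G" "v \<in> pverts G"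
  shows "d + 2 \<le> card (pverts G)"
proof -
  have "pverts G - (pverts G - {v}) = {v}" using assms(3) by blast
  then have "\<not> card (pverts G - {v}) < Suc d"
    using assms(2)[unfolded vertex_connected_iff, rule_format, of "pverts G - {v}"] by auto
  then show ?thesis
    using card_Suc_Diff1[OF pair_graphD(1)[OF assms(1)] assms(3)] by linarith
qed

text \<open>With \<open>v\<close> removed, every edge cut has size at least \<open>d\<close>. If all
  pairs across are adjacent, this is a count of vertices; otherwise a smaller cut would give a
  separating set of at most \<open>d\<close> vertices, including \<open>v\<close>.\<close>

lemma card_cut_ge_vertex_connected:
  assumes G: "pair_graph G" and conn: "vertex_connected (Suc d) G"
    and V: "pverts G = insert v (C \<union> D)" "v \<notin> C" "v \<notin> D" "C \<inter> D = {}" "C \<noteq> {}" "D \<noteq> {}"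
  shows "d \<le> card (parcs G \<inter> C \<times> D)"
proof (rule ccontr)
  let ?K = "parcs G \<inter> C \<times> D"
  assume small: "\<not> d \<le> card ?K"
  have fin: "finite C" "finite D" using pair_graphD(1)[OF G] V(1) by simp_all
  then have finK: "finite ?K" by simp
  show False
  proof (cases "C \<times> D \<subseteq> parcs G")
    case True
    then have "?K = C \<times> D" by blast
    then have "card ?K = card C * card D" by (simp add: card_cartesian_product)
    moreover have "card (pverts G) = Suc (card C + card D)"
      using V fin by (simp add: card_Un_disjoint)
    moreover have "d + 2 \<le> card (pverts G)"
      using V(1) by (intro card_verts_ge_vertex_connected[OF G conn, of v]) simp
    \<comment> \<open>With these values the cut has \<open>p * q + p + q + 1\<close> arcs, while the
      vertex count gives \<open>d \<le> p + q + 1\<close>.\<close>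
    moreover obtain p q where "card C = Suc p" "card D = Suc q"
      using V(5,6) fin by (metis card_eq_0_iff not0_implies_Suc)
    ultimately show False using small by simp
  next
    case False
    then obtain c e where ce: "c \<in> C" "e \<in> D" "(c, e) \<notin> parcs G" by blast
    \<comment> \<open>Each arc of the cut loses an endpoint, but \<open>c\<close> and \<open>e\<close> survive.\<close>
    let ?S = "insert v ((\<lambda>(x, y). if x \<noteq> c then x else y) ` ?K)"
    have S: "?S \<subseteq> pverts G" "c \<notin> ?S" "e \<notin> ?S"
      using V ce by (auto split: if_splits)
    have "card ?S \<le> Suc (card ?K)"
      using card_insert_le_m1 finK card_image_le[OF finK, of "\<lambda>(x, y). if x \<noteq> c then x else y"]
      by (simp add: card_insert_if)
    then have con: "connected_on (parcs G) (pverts G - ?S)"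
      using small conn S(1)
      by (intro connected_induce_subgraph_imp_connected_on[OF G]) (auto simp: vertex_connected_iff)
    have "C - ?S \<subseteq> pverts G - ?S" using V(1) by blast
    moreover have "c \<in> C - ?S" using ce(1) S(2) by (rule DiffI)
    moreover have "e \<in> (pverts G - ?S) - (C - ?S)" using ce(2) S(3) V(1,4) by blast
    ultimately obtain a b where "a \<in> C - ?S" "b \<in> (pverts G - ?S) - (C - ?S)" "(a, b) \<in> parcs G"
      by (rule connected_onE[OF con])
    \<comment> \<open>Since \<open>v\<close> is deleted, \<open>b\<close> lies in \<open>D\<close>;
      but every arc of the cut has lost an endpoint.\<close>
    moreover from this have "(a, b) \<in> ?K" using V(1) by auto
    ultimately show False by (force split: if_splits)
  qed
qed

text \<open>Connectivity by edge cuts. \<open>Q\<close> is not confined to \<open>W\<close>, so any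
  union of edges can be used as a test set.\<close>

definition spanning_connected :: "'a set \<Rightarrow> 'a set set \<Rightarrow> bool" where
  "spanning_connected W U \<longleftrightarrow>
    (\<forall>Q. Q \<inter> W \<noteq> {} \<longrightarrow> W - Q \<noteq> {} \<longrightarrow> (\<exists>e\<in>U. e \<inter> Q \<noteq> {} \<and> e - Q \<noteq> {}))"

lemma spanning_connectedE:
  assumes "spanning_connected W U" "x \<in> W" "x \<in> Q" "y \<in> W" "y \<notin> Q"
  obtains e where "e \<in> U" "e \<inter> Q \<noteq> {}" "e - Q \<noteq> {}"
  using assms unfolding spanning_connected_def by blast

lemma edge_disjoint_spanning_subgraphs:
  assumes G: "pair_graph G" and conn: "vertex_connected (Suc (2 * m)) G" and v: "v \<in> pverts G"
  shows "\<exists>U. (\<forall>j<m. U j \<subseteq> edges G \<and> (\<forall>e\<in>U j. v \<notin> e) \<and> spanning_connected (pverts G - {v}) (U j))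
    \<and> (\<forall>i<m. \<forall>j<m. i \<noteq> j \<longrightarrow> U i \<inter> U j = {})"
proof -
  note GD = pair_graphD[OF G]
  define V where "V = pverts G - {v}"
  \<comment> \<open>The numbering orients every edge upwards, so that \<open>E\<close> contains each
    undirected edge avoiding \<open>v\<close> exactly once.\<close>
  obtain f :: "'a \<Rightarrow> nat" where f: "inj_on f (pverts G)"
    using finite_imp_inj_to_nat_seg[OF GD(1)] by blast
  define E where "E = {(x, y) \<in> parcs G. x \<in> V \<and> y \<in> V \<and> f x < f y}"
  have cut: "2 * m \<le> card {(x, y) \<in> E. (x \<in> C) \<noteq> (y \<in> C)}" if C: "C \<subset> V" "C \<noteq> {}" for C
  proof -
    let ?D = "V - C"
    let ?g = "\<lambda>(x, y). if f x < f y then (x, y) else (y, x)"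
    have "2 * m \<le> card (parcs G \<inter> C \<times> ?D)"
      by (rule card_cut_ge_vertex_connected[OF G conn, of v]) (use C v in \<open>auto simp: V_def\<close>)
    also have "\<dots> \<le> card {(x, y) \<in> E. (x \<in> C) \<noteq> (y \<in> C)}"
    proof (rule card_inj_on_le)
      show "inj_on ?g (parcs G \<inter> C \<times> ?D)"
        by (rule inj_onI) (auto split: if_splits)
      show "?g ` (parcs G \<inter> C \<times> ?D) \<subseteq> {(x, y) \<in> E. (x \<in> C) \<noteq> (y \<in> C)}"
      proof (rule image_subsetI)
        fix e assume "e \<in> parcs G \<inter> C \<times> ?D"
        then obtain x y where e: "e = (x, y)"
          and xy: "(x, y) \<in> parcs G" "x \<in> C" "y \<in> V" "y \<notin> C" by auto
        have "x \<noteq> y" using xy by blast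
        moreover have "x \<in> pverts G" "y \<in> pverts G" using xy(1) GD(2) by auto
        ultimately have "f x \<noteq> f y" using f by (auto dest: inj_onD)
        then show "?g e \<in> {(x, y) \<in> E. (x \<in> C) \<noteq> (y \<in> C)}"
          using xy GD(3) C(1) by (auto simp: E_def e)
      qed
      have "E \<subseteq> pverts G \<times> pverts G" using GD(2) by (auto simp: E_def)
      then have "finite E" using GD(1) finite_subset by blast
      then show "finite {(x, y) \<in> E. (x \<in> C) \<noteq> (y \<in> C)}"
        by (rule rev_finite_subset) auto
    qed
    finally show ?thesis .
  qed
  have finV: "finite V" and EV: "E \<subseteq> V \<times> V"
    using GD(1) by (auto simp: V_def E_def)
  let ?h = "\<lambda>(x, y). {x, y}"
  \<comment> \<open>Forgetting the orientation is injective on \<open>E\<close>, hence disjoint sets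
    of pairs become disjoint sets of edges.\<close>
  have h: "inj_on ?h E"
    by (rule inj_onI) (auto simp: E_def doubleton_eq_iff)
  show ?thesis
  proof (rule edge_disjoint_spanning_packing[OF finV EV, of m])
    fix F
    assume F: "\<And>i. i < m \<Longrightarrow> F i \<subseteq> E" "\<And>i j. i < m \<Longrightarrow> j < m \<Longrightarrow> i \<noteq> j \<Longrightarrow> F i \<inter> F j = {}"
      and span: "\<And>i. i < m \<Longrightarrow> V \<times> V \<subseteq> eqvcl (F i)"
    show ?thesis
    proof (intro exI[of _ "\<lambda>j. ?h ` F j"] conjI allI impI)
      show "?h ` F j \<subseteq> edges G" if "j < m" for j
        using F(1)[OF that] by (auto simp: edges_def E_def)
      show "\<forall>e\<in>?h ` F j. v \<notin> e" if "j < m" for j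
        using F(1)[OF that] by (auto simp: E_def V_def)
      show "?h ` F i \<inter> ?h ` F j = {}" if "i < m" "j < m" "i \<noteq> j" for i j
        using inj_on_image_Int[OF h F(1)[OF that(1)] F(1)[OF that(2)]] F(2)[OF that] by simp
      show "spanning_connected (pverts G - {v}) (?h ` F j)" if j: "j < m" for j
        unfolding spanning_connected_def V_def[symmetric]
      proof (intro allI impI)
        fix Q assume "Q \<inter> V \<noteq> {}" "V - Q \<noteq> {}"
        then obtain x y where xy: "x \<in> V" "x \<in> Q" "y \<in> V" "y \<notin> Q" by blast
        then have "(x, y) \<in> eqvcl (F j)" using span[OF j] by auto
        then obtain a b where ab: "(a, b) \<in> F j \<or> (b, a) \<in> F j" "a \<in> Q" "b \<notin> Q"
          using xy(2,4) by (rule eqvcl_cut)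
        from ab(1) have "{a, b} \<in> ?h ` F j"
        proof
          assume "(a, b) \<in> F j"
          then show ?thesis by (rule rev_image_eqI) simp
        next
          assume "(b, a) \<in> F j"
          then show ?thesis by (rule rev_image_eqI) auto
        qed
        then show "\<exists>e\<in>?h ` F j. e \<inter> Q \<noteq> {} \<and> e - Q \<noteq> {}"
          using ab(2,3) by (intro bexI[of _ "{a, b}"]) auto
      qed
    qed
  next
    fix C assume "C \<subset> V" "C \<noteq> {}"
    then show "2 * m \<le> card {(x, y) \<in> E. (x \<in> C) \<noteq> (y \<in> C)}" by (rule cut)
  qed
qed

text \<open>Take as test set the vertices covered by one part \<open>X\<close> of the edges. Either
  an edge of the other part already touches it, or some edge of \<open>U\<close> leaves it; that
  edge is outside \<open>X\<close> and meets an edge of \<open>X\<close>.\<close>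

lemma connected_on_total_graph_spanning:
  assumes U: "U \<subseteq> edges G" "\<And>e. e \<in> U \<Longrightarrow> v \<notin> e" and G: "pair_graph G"
    and span: "spanning_connected (pverts G - {v}) U"
  shows "connected_on (parcs (total_graph G)) (Inr ` U)"
proof (rule connected_onI)
  fix Z and x y :: "'a + 'a set" assume Z: "Z \<subseteq> Inr ` U" "x \<in> Z" "y \<in> Inr ` U - Z"
  define X where "X = Inr -` Z"
  have X: "X \<subseteq> U" using vimage_mono[OF Z(1), of Inr] by (simp add: X_def inj_vimage_image_eq)
  obtain e f where xy: "x = Inr e" "y = Inr f" "f \<in> U" using Z by blast
  then have ef: "e \<in> X" "f \<in> U - X" using Z(2,3) by (simp_all add: X_def)
  have edge: "g \<noteq> {} \<and> g \<subseteq> pverts G - {v}" if "g \<in> U" for g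
    using U that pair_graphD(2)[OF G] by (auto simp: edges_def)
  obtain a b where ab: "a \<in> e" "b \<in> f" "a \<in> pverts G - {v}" "b \<in> pverts G - {v}"
    using edge[of e] edge[of f] ef X by blast
  have "\<exists>g\<in>X. \<exists>g'\<in>U - X. g \<inter> g' \<noteq> {}"
  proof (cases "b \<in> \<Union>X")
    case True
    then show ?thesis using ab(2) ef(2) by blast
  next
    case False
    have "a \<in> \<Union>X" using ab(1) ef(1) by blast
    with span ab(3) obtain g where "g \<in> U" "g \<inter> \<Union>X \<noteq> {}" "g - \<Union>X \<noteq> {}"
      using ab(4) False by (rule spanning_connectedE)
    then show ?thesis by blast
  qed
  then obtain g g' where g: "g \<in> X" "g' \<in> U - X" "g \<inter> g' \<noteq> {}" by blast
  then have "g \<in> edges G" "g' \<in> edges G" "g \<noteq> g'" using X U(1) by blast+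
  then have "(Inr g, Inr g') \<in> parcs (total_graph G)"
    using g(3) by (simp add: total_graph_def)
  moreover have "Inr g \<in> Z" "Inr g' \<in> Inr ` U - Z" using g by (auto simp: X_def)
  ultimately show "\<exists>a\<in>Z. \<exists>b\<in>Inr ` U - Z. (a, b) \<in> parcs (total_graph G)" by blast
qed

lemma connected_on_total_graph_verts:
  assumes "connected_on (parcs G) W"
  shows "connected_on (parcs (total_graph G)) (Inl ` W)"
proof (rule connected_onI)
  fix Z and x y :: "'a + 'a set" assume Z: "Z \<subseteq> Inl ` W" "x \<in> Z" "y \<in> Inl ` W - Z"
  let ?X = "{w. Inl w \<in> Z}"
  have "?X \<subseteq> W" using Z(1) by blast
  moreover obtain x' y' where "x' \<in> ?X" "y' \<in> W - ?X" using Z by blast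
  ultimately obtain a b where "a \<in> ?X" "b \<in> W - ?X" "(a, b) \<in> parcs G"
    by (rule connected_onE[OF assms])
  then show "\<exists>a\<in>Z. \<exists>b\<in>Inl ` W - Z. (a, b) \<in> parcs (total_graph G)"
    by (intro bexI[of _ "Inl a"] bexI[of _ "Inl b"]) (auto simp: total_graph_def)
qed

theorem theorem11:
  fixes G :: "'a pair_pre_digraph" and k :: nat
  assumes "1 \<le> k"
    and "pair_graph G"
    and "vertex_connected (2 * k - 1) G"
  shows "has_minor (total_graph G) (complete_graph (max_degree G + k))"
proof -
  define m where "m = k - 1"
  have conn: "vertex_connected (Suc (2 * m)) G" and k: "k = Suc m"
  proof -
    show k: "k = Suc m" using assms(1) by (simp add: m_def)
    show "vertex_connected (Suc (2 * m)) G" using assms(3) by (simp add: k)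
  qed
  note GD = pair_graphD[OF assms(2)]
  let ?T = "total_graph G" and ?V = "pverts G"
  note TD = pair_graphD[OF pair_graph_total_graph[OF assms(2)]]
  \<comment> \<open>Deleting the empty set is allowed since the connectivity bound is positive; this
    also makes the maximum degree a maximum over a nonempty set.\<close>
  have "Digraph_Component.connected (with_proj G \<restriction> ?V)"
    using conn[unfolded vertex_connected_iff, rule_format, of "{}"] by simp
  then have connV: "connected_on (parcs G) ?V" and "?V \<noteq> {}"
    using connected_induce_subgraph_imp_connected_on[OF assms(2)]
    by (auto simp: Digraph_Component.connected_def strongly_connected_def)
  then have "max_degree G \<in> out_degree (with_proj G) ` ?V"
    unfolding max_degree_def using GD(1) by (intro Max_in) auto
  then obtain v where v: "v \<in> ?V" "max_degree G = out_degree (with_proj G) v" by blast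
  define N where "N = {u. (v, u) \<in> parcs G}"
  define d where "d = card N"
  have NV: "N \<subseteq> ?V - {v}" using GD(2,4) by (auto simp: N_def)
  then have finN: "finite N" using GD(1) finite_subset by blast
  have "out_arcs (with_proj G) v = Pair v ` N" by (auto simp: out_arcs_def N_def)
  then have deg: "max_degree G = d"
    using v(2) by (simp add: out_degree_def card_image inj_on_def d_def)
  obtain h where "bij_betw h {0..<d} N" using ex_bij_betw_nat_finite[OF finN] by (auto simp: d_def)
  then have h: "h i \<in> N" and h_inj: "j < d \<Longrightarrow> h i = h j \<Longrightarrow> i = j" if "i < d" for i j
    using that by (auto simp: bij_betw_def inj_on_def)
  obtain U where "\<forall>j<m. U j \<subseteq> edges G \<and> (\<forall>e\<in>U j. v \<notin> e) \<and> spanning_connected (?V - {v}) (U j)"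
    and disj: "\<forall>i<m. \<forall>j<m. i \<noteq> j \<longrightarrow> U i \<inter> U j = {}"
    using edge_disjoint_spanning_subgraphs[OF assms(2) conn v(1)] by blast
  then have U: "U j \<subseteq> edges G" "e \<in> U j \<Longrightarrow> v \<notin> e" "spanning_connected (?V - {v}) (U j)"
    if "j < m" for j e
    using that by metis+
  \<comment> \<open>The cut \<open>{x}\<close> yields the edge. It needs a vertex besides
    \<open>v\<close> and \<open>x\<close>, which exists because \<open>j < m\<close> forces at least
    four vertices.\<close>
  have cover: "\<exists>e\<in>U j. x \<in> e" if jx: "j < m" "x \<in> ?V - {v}" for j x
  proof -
    have "2 * m + 2 \<le> card ?V" by (rule card_verts_ge_vertex_connected[OF assms(2) conn v(1)])
    then have "card {v, x} < card ?V" using jx(1) by (simp add: card_insert_if)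
    then have "\<not> ?V \<subseteq> {v, x}" using card_mono[of "{v, x}" ?V] by auto
    then obtain y where "y \<in> ?V - {v}" "y \<notin> {x}" by blast
    with U(3)[OF jx(1)] jx(2) singletonI obtain e where "e \<in> U j" "e \<inter> {x} \<noteq> {}"
      by (rule spanning_connectedE)
    then show ?thesis by blast
  qed
  have nonempty: "\<exists>x. x \<in> ?V - {v}" if "j < m" for j
  proof -
    have "2 * m + 2 \<le> card ?V" by (rule card_verts_ge_vertex_connected[OF assms(2) conn v(1)])
    then have "\<not> ?V \<subseteq> {v}" using card_mono[of "{v}" ?V] by auto
    then show ?thesis by blast
  qed
  have star: "{v, h i} \<in> edges G" if "i < d" for i
    using h[OF that] by (auto simp: edges_def N_def)
  \<comment> \<open>The \<open>d\<close> edges at \<open>v\<close>, the whole vertex set, and the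
    \<open>m = k - 1\<close> spanning edge sets give \<open>d + 1 + m = d + k\<close> bags.\<close>
  define B :: "nat \<Rightarrow> ('a + 'a set) set" where
    "B i = (if i < d then {Inr {v, h i}} else if i = d then Inl ` ?V else Inr ` U (i - Suc d))" for i
  have B_star: "B i = {Inr {v, h i}}" if "i < d" for i using that by (simp add: B_def)
  have B_verts: "B d = Inl ` ?V" by (simp add: B_def)
  have B_span: "B (Suc d + j) = Inr ` U j" for j by (simp add: B_def)
  have ix: "i < d \<or> i = d \<or> (\<exists>j<m. i = Suc d + j)" if "i < d + k" for i
  proof -
    have "i - Suc d < m \<and> i = Suc d + (i - Suc d)" if "d < i" using that \<open>i < d + k\<close> k by simp
    then show ?thesis by (cases i d rule: linorder_cases) blast+
  qed
  have pair: "B i \<inter> B j = {} \<and> (\<exists>x\<in>B i. \<exists>y\<in>B j. (x, y) \<in> parcs ?T)"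
    if ij: "i < j" "j < d + k" for i j
  proof -
    have "i < d + k" using ij by simp
    note ixs = ix[OF this] ix[OF ij(2)]
    consider "i < d" "j < d" | "i < d" "j = d" | l where "i < d" "l < m" "j = Suc d + l"
      | l where "i = d" "l < m" "j = Suc d + l"
      | l l' where "l < m" "l' < m" "l \<noteq> l'" "i = Suc d + l" "j = Suc d + l'"
    proof (cases "j \<le> d")
      case True
      then show thesis using ij(1) that(1,2) by (cases "j = d") auto
    next
      case False
      then obtain l' where j: "l' < m" "j = Suc d + l'" using ixs(2) by auto
      from ixs(1) show thesis
      proof (elim disjE exE conjE)
        fix l assume l: "l < m" "i = Suc d + l"
        then have "l \<noteq> l'" using j ij(1) by simp
        then show thesis using that(5)[OF l(1) j(1) _ l(2) j(2)] by blast
      qed (use j that(3,4) in blast)+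
    qed
    then show ?thesis
    proof cases
      case 1
      then have "h i \<noteq> h j" using h_inj[of i j] ij(1) by auto
      then have "{v, h i} \<noteq> {v, h j}" by (auto simp: doubleton_eq_iff)
      then show ?thesis using 1 star by (auto simp: B_star total_graph_def)
    next
      case 2
      have "(Inr {v, h i}, Inl v) \<in> parcs ?T" using star[OF 2(1)] by (auto simp: total_graph_def)
      then show ?thesis using 2 v(1) by (auto simp: B_star B_verts)
    next
      case 3
      \<comment> \<open>\<open>U l\<close> covers the far end \<open>h i\<close> of the edge at
        \<open>v\<close> by an edge avoiding \<open>v\<close>, hence by a different edge.\<close>
      have "h i \<in> ?V - {v}" using h[OF 3(1)] NV by blast
      then obtain e where e: "e \<in> U l" "h i \<in> e" using cover[OF 3(2)] by blast
      have "v \<notin> e" using U(2)[OF 3(2) e(1)] .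
      then have "(Inr {v, h i}, Inr e) \<in> parcs ?T"
        using star[OF 3(1)] U(1)[OF 3(2)] e by (auto simp: total_graph_def)
      moreover have "{v, h i} \<notin> U l" using U(2)[OF 3(2)] by blast
      ultimately show ?thesis unfolding 3(3) B_star[OF 3(1)] B_span using e(1) by blast
    next
      case 4
      obtain x where x: "x \<in> ?V - {v}" using nonempty[OF 4(2)] by blast
      obtain e where e: "e \<in> U l" "x \<in> e" using cover[OF 4(2) x] by blast
      have "(Inl x, Inr e) \<in> parcs ?T"
        using U(1)[OF 4(2)] e by (auto simp: total_graph_def)
      then show ?thesis unfolding 4(1,3) B_verts B_span using e(1) x by blast
    next
      case 5
      \<comment> \<open>Both edge sets cover \<open>x\<close>; disjointness makes the two covering
        edges distinct.\<close>
      obtain x where x: "x \<in> ?V - {v}" using nonempty[OF 5(1)] by blast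
      obtain e where e: "e \<in> U l" "x \<in> e" using cover[OF 5(1) x] by blast
      obtain e' where e': "e' \<in> U l'" "x \<in> e'" using cover[OF 5(2) x] by blast
      have "e \<noteq> e'" using disj 5(1-3) e e' by blast
      then have "(Inr e, Inr e') \<in> parcs ?T"
        using U(1)[OF 5(1)] U(1)[OF 5(2)] e e' by (auto simp: total_graph_def)
      then show ?thesis
        unfolding 5(4,5) B_span using e(1) e'(1) disj 5(1-3) by blast
    qed
  qed
  have "complete_bags ?T (d + k) B"
  proof (rule complete_bagsI)
    fix i assume "i < d + k"
    then consider "i < d" | "i = d" | j where "j < m" "i = Suc d + j" using ix by blast
    then have "B i \<subseteq> pverts ?T \<and> B i \<noteq> {} \<and> connected_on (parcs ?T) (B i)"
    proof cases
      case 1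
      then show ?thesis using star by (auto simp: B_star total_graph_def connected_on_def)
    next
      case 2
      then show ?thesis
        using \<open>?V \<noteq> {}\<close> connected_on_total_graph_verts[OF connV]
        by (auto simp: B_verts total_graph_def)
    next
      case 3
      have "U j \<noteq> {}" using nonempty[OF 3(1)] cover[OF 3(1)] by blast
      moreover have "connected_on (parcs ?T) (Inr ` U j)"
        using U(1)[OF 3(1)] U(2)[OF 3(1)] assms(2) U(3)[OF 3(1)]
        by (rule connected_on_total_graph_spanning)
      ultimately show ?thesis
        unfolding 3(2) B_span using U(1)[OF 3(1)] by (auto simp: total_graph_def)
    qed
    then show "B i \<subseteq> pverts ?T" "B i \<noteq> {}" "connected_on (parcs ?T) (B i)" by blast+
  next
    fix i j assume ij: "i < d + k" "j < d + k" "i \<noteq> j"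
    \<comment> \<open>The facts in \<open>pair\<close> concern ordered indices only; symmetry of
      intersection and of the total graph covers the other order.\<close>
    show "B i \<inter> B j = {}"
      using pair[of i j] pair[of j i] ij by (metis Int_commute linorder_neqE_nat)
    show "\<exists>x\<in>B i. \<exists>y\<in>B j. (x, y) \<in> parcs ?T"
      using pair[of i j] pair[of j i] ij TD(3) by (metis linorder_neqE_nat)
  qed
  then show ?thesis
    unfolding deg by (rule has_minor_complete_graph_if_bags[OF pair_graph_total_graph[OF assms(2)]])
qed

end
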